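(* Let $M_1$ and $M_2$ be polynomials not identically zero, and let $h$ be a non-zero complex number. Then for every polynomial $p\in\mathbb{R}[x]$ with only real zeros, the polynomial $$M_1(z)\,p(z+h)+M_2(z)\,p(z-h)$$ has only real zeros if, and only if, $\operatorname{Re} h=0$, and either $\left|\dfrac{M_1(z)}{M_2(z)}\right|\equiv 1$, or $M_1(z)=e^{i\theta}\cdot\overline{M_2(\bar z)}$ with $\theta\in[0,2\pi)$ and all the zeros of the polynomial $M_2$ lie in the half-plane $\operatorname{Im} h\cdot\operatorname{Im} z\geqslant 0$.
   Context: The equivalence is between the property "for every real polynomial $p$ with only real zeros, $M_1(z)p(z+h)+M_2(z)p(z-h)$ has only real zeros" and the stated conditions on $h$, $M_1$, $M_2$. The polynomials $M_1$, $M_2$ may have complex coefficients; the bar denotes complex conjugation.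
   Formalization: |M1/M2| ≡ 1 is required at every complex z with M2(z) ≠ 0 everywhere, so M1, M2 are constants there; as an identity of rational functions the claim fails for M1 = M2 = z − i, h = i, p = 1. The zero polynomial counts as having only real zeros. *)

theory Defs
  imports Complex_Main "HOL-Computational_Algebra.Polynomial"
begin

text \<open>The identically zero polynomial counts as having only real zeros. This is needed: a
  difference operator such as \<open>p(z + h) - p(z - h)\<close> annihilates the constants.\<close>

definition only_real_zeros :: "complex poly \<Rightarrow> bool" where
  "only_real_zeros q \<longleftrightarrow> q = 0 \<or> (\<forall>z. poly q z = 0 \<longrightarrow> z \<in> \<real>)"

definition diff_op ::
    "complex poly \<Rightarrow> complex poly \<Rightarrow> complex \<Rightarrow> complex poly \<Rightarrow> complex poly" where
  "diff_op M1 M2 h p = M1 * pcompose p [:h, 1:] + M2 * pcompose p [:- h, 1:]"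

lemma poly_diff_op:
  "poly (diff_op M1 M2 h p) z = poly M1 z * poly p (z + h) + poly M2 z * poly p (z - h)"
  by (simp add: diff_op_def poly_pcompose add.commute)

text \<open>In the theorem the quotient \<open>M1 z / M2 z\<close> is required to be defined and of modulus one at
  every complex point \<open>z\<close>. As \<open>x / 0 = 0\<close> in HOL, this forces \<open>M2\<close> to have no zeros. Reading
  the identity only off the zeros of \<open>M2\<close> would admit \<open>M1 = M2 = z - \<i>\<close>, \<open>h = \<i>\<close>, where
  \<open>p = 1\<close> is sent to \<open>2 (z - \<i>)\<close>, so that the equivalence would fail. If \<open>M1 = c M2\<close> with
  \<open>|c| = 1\<close> and \<open>M2\<close> has only real zeros, the second alternative applies.\<close>

end

theory Submission
  imports Defs "HOL-Computational_Algebra.Fundamental_Theorem_Algebra"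
begin

text \<open>
  Everything rests on three consequences of the factorisation of a complex polynomial \<open>q\<close> with only
  real zeros into factors \<open>z - a\<close> with \<open>a\<close> real: \<open>q\<close> satisfies the Laguerre inequality at real points
  (\<open>real_rooted_Laguerre\<close>), it is a unimodular multiple of its conjugate \<open>cnj (q (cnj z))\<close>
  (\<open>real_rooted_cnj\<close>), and its modulus grows along vertical lines away from the real axis
  (\<open>real_rooted_cmod_mono\<close>).

  For necessity, these are applied to the images
  \<open>q = M1(z) (z + h - c)^n + M2(z) (z - h - c)^n\<close> of the powers \<open>(x - c)^n\<close>, with \<open>c\<close> real.

  \<^item> The quantity \<open>(q q'' - q'^2) / q^2\<close> at \<open>c\<close> is real and nonpositive by the Laguerre inequality. To
    leading order in \<open>n\<close> it is \<open>n^2\<close> times \<open>4 \<sigma> M1 M2 / (h (M1 + \<sigma> M2))^2\<close>, taken at \<open>c\<close>, with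
    \<open>\<sigma> = 1\<close> for even and \<open>\<sigma> = -1\<close> for odd \<open>n\<close>. The reciprocals of these two limits add up to
    \<open>h^2\<close>, so \<open>h^2\<close> is real and nonpositive, that is, \<open>Re h = 0\<close> (\<open>preserves_imp_Re_0\<close>).

  \<^item> Now \<open>cnj h = - h\<close>, so conjugation swaps the two powers in \<open>q\<close>. For large \<open>n\<close> the coprimality of
    \<open>(z + h)^n\<close> and \<open>(z - h)^n\<close> turns the conjugation symmetry of \<open>q\<close> into one of the pair
    \<open>M1\<close>, \<open>M2\<close> (\<open>preserves_imp_cnj\<close>).

  \<^item> In the half-plane \<open>Im h * Im z > 0\<close> the power \<open>(z + h - c)^n\<close> dominates \<open>(z - h - c)^n\<close>. At a zero
    \<open>w\<close> of \<open>M1\<close> in that half-plane only the second one survives, so \<open>q\<close> would be smaller at \<open>w\<close> than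
    at a point vertically between \<open>w\<close> and the real axis, against the monotonicity
    (\<open>preserves_imp_zero_location\<close>). The zeros of \<open>M2\<close> are the conjugates of those of \<open>M1\<close>.

  For sufficiency, if \<open>|M1 / M2| = 1\<close> everywhere then neither polynomial has a zero, both are
  constant, and the second alternative holds. In the second alternative, comparing distances to the
  zeros factor by factor gives \<open>|M2(z)| \<le> |M1(z)|\<close> and \<open>|p(z - h)| \<le> |p(z + h)|\<close> when
  \<open>Im h * Im z > 0\<close>. One of the inequalities is strict unless \<open>p\<close> is constant and \<open>M2\<close> has only real
  zeros, in which case the image of \<open>p\<close> is a multiple of \<open>M2\<close>. So the image has no zero in this
  half-plane (\<open>cnj_pair_no_zero_above\<close>), nor, by conjugation symmetry, in the opposite one.
\<close>

section \<open>Complex polynomials as products of linear factors\<close>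

lemma complex_poly_induct [case_names const linear_factor]:
  fixes q :: "complex poly"
  assumes "\<And>c. Q [:c:]" and "\<And>a p. Q p \<Longrightarrow> Q ([:- a, 1:] * p)"
  shows "Q q"
proof (induction "degree q" arbitrary: q rule: less_induct)
  case less
  show ?case
  proof (cases "degree q = 0")
    case True
    then show ?thesis using assms(1) by (metis degree_0_id)
  next
    case False
    then obtain a where "poly q a = 0"
      using fundamental_theorem_of_algebra[of q] by (auto simp: constant_degree)
    then obtain r where r: "q = [:- a, 1:] * r"
      by (metis dvdE poly_eq_0_iff_dvd)
    moreover have "r \<noteq> 0" using r False by auto
    ultimately have "degree r < degree q" by (simp add: degree_mult_eq del: mult_pCons_left)
    then show ?thesis using less assms(2) r by blast
  qed
qed

text \<open>All the size comparisons below are of this kind: a polynomial grows in modulus when passing to a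
  point that is farther from each of its zeros.\<close>

lemma cmod_poly_mono:
  fixes q :: "complex poly"
  assumes "\<And>a. poly q a = 0 \<Longrightarrow> cmod (z - a) \<le> cmod (w - a)"
  shows "cmod (poly q z) \<le> cmod (poly q w)"
  using assms
proof (induction q rule: complex_poly_induct)
  case (linear_factor a p)
  then have "cmod (z - a) * cmod (poly p z) \<le> cmod (w - a) * cmod (poly p w)"
    by (intro mult_mono) auto
  then show ?case by (simp add: norm_mult del: mult_pCons_left)
qed simp

lemma cmod_poly_strict_mono:
  fixes q :: "complex poly"
  assumes mono: "\<And>a. poly q a = 0 \<Longrightarrow> cmod (z - a) \<le> cmod (w - a)"
    and root: "poly q a = 0" and strict: "cmod (z - a) < cmod (w - a)" and nz: "poly q w \<noteq> 0"
  shows "cmod (poly q z) < cmod (poly q w)"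
proof -
  obtain r where r: "q = [:- a, 1:] * r"
    using root by (metis dvdE poly_eq_0_iff_dvd)
  have "cmod (poly r z) \<le> cmod (poly r w)"
    using mono by (intro cmod_poly_mono) (auto simp: r)
  then have "cmod (z - a) * cmod (poly r z) \<le> cmod (z - a) * cmod (poly r w)"
    by (rule mult_left_mono) simp
  also have "\<dots> < cmod (w - a) * cmod (poly r w)"
    using strict nz by (intro mult_strict_right_mono) (auto simp: r)
  finally have "cmod (z - a) * cmod (poly r z) < cmod (w - a) * cmod (poly r w)" .
  then show ?thesis by (simp add: r norm_mult del: mult_pCons_left)
qed

lemma cmod_diff_less_iff:
  "cmod (z - a) < cmod (w - a) \<longleftrightarrow>
    (Re z - Re a)\<^sup>2 + (Im z - Im a)\<^sup>2 < (Re w - Re a)\<^sup>2 + (Im w - Im a)\<^sup>2"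
  by (simp add: cmod_def)

lemma cmod_diff_le_iff:
  "cmod (z - a) \<le> cmod (w - a) \<longleftrightarrow>
    (Re z - Re a)\<^sup>2 + (Im z - Im a)\<^sup>2 \<le> (Re w - Re a)\<^sup>2 + (Im w - Im a)\<^sup>2"
  by (simp add: cmod_def)

lemma real_rooted_cmod_mono:
  assumes "only_real_zeros q" and "Re z = Re w" and "\<bar>Im z\<bar> \<le> \<bar>Im w\<bar>"
  shows "cmod (poly q z) \<le> cmod (poly q w)"
proof (cases "q = 0")
  case False
  show ?thesis
  proof (rule cmod_poly_mono)
    fix a assume "poly q a = 0"
    then have "Im a = 0" using assms(1) False by (auto simp: only_real_zeros_def complex_is_Real_iff)
    then show "cmod (z - a) \<le> cmod (w - a)"
      using assms(2,3) by (simp add: cmod_diff_le_iff abs_le_square_iff)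
  qed
qed simp

text \<open>Each linear factor is its own conjugate, so only the leading coefficient contributes to \<open>\<mu>\<close>.\<close>

lemma real_rooted_cnj:
  assumes "only_real_zeros q"
  obtains \<mu> where "cmod \<mu> = 1" and "\<And>z. cnj (poly q (cnj z)) = \<mu> * poly q z"
proof -
  have "\<exists>\<mu>. cmod \<mu> = 1 \<and> (\<forall>z. cnj (poly q (cnj z)) = \<mu> * poly q z)"
    if "\<forall>z. poly q z = 0 \<longrightarrow> z \<in> \<real>"
    using that
  proof (induction q rule: complex_poly_induct)
    case (const c)
    show ?case
    proof (cases "c = 0")
      case False
      then show ?thesis by (intro exI[of _ "cnj c / c"]) (auto simp: norm_divide)
    qed (auto intro: exI[of _ 1])
  next
    case (linear_factor a p)
    then obtain \<mu> where "cmod \<mu> = 1" "\<forall>z. cnj (poly p (cnj z)) = \<mu> * poly p z" by auto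
    moreover have "a \<in> \<real>" using linear_factor.prems by simp
    ultimately show ?case by (intro exI[of _ \<mu>]) (auto simp: Reals_cnj_iff algebra_simps)
  qed
  moreover have "\<exists>\<mu>. cmod \<mu> = 1 \<and> (\<forall>z. cnj (poly 0 (cnj z)) = \<mu> * poly 0 z)"
    by (intro exI[of _ 1]) simp
  ultimately show ?thesis
    using assms that unfolding only_real_zeros_def by blast
qed

text \<open>For \<open>q(c) \<noteq> 0\<close> the number \<open>S\<close> is the sum of \<open>1 / (c - a)^2\<close> over the zeros \<open>a\<close>, since
  \<open>(q q'' - q'^2) / q^2\<close> is the derivative of the logarithmic derivative of \<open>q\<close>. For complex
  coefficients the content lies in this quotient being real as well as nonpositive.\<close>

lemma real_rooted_Laguerre:
  fixes c :: real
  assumes "only_real_zeros q" and "poly q (of_real c) \<noteq> 0"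
  obtains S where "S \<ge> 0"
    and "poly q c * poly (pderiv (pderiv q)) c - (poly (pderiv q) c)\<^sup>2 = - of_real S * (poly q c)\<^sup>2"
proof -
  have "\<forall>z. poly q z = 0 \<longrightarrow> z \<in> \<real>" using assms by (auto simp: only_real_zeros_def)
  then have "\<exists>S\<ge>0. poly q c * poly (pderiv (pderiv q)) c - (poly (pderiv q) c)\<^sup>2
      = - of_real S * (poly q c)\<^sup>2"
    using assms(2)
  proof (induction q rule: complex_poly_induct)
    case (const c)
    show ?case by (intro exI[of _ 0]) (simp add: pderiv_pCons)
  next
    case (linear_factor a p)
    then obtain S where S: "S \<ge> 0"
      "poly p c * poly (pderiv (pderiv p)) c - (poly (pderiv p) c)\<^sup>2 = - of_real S * (poly p c)\<^sup>2"
      by auto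
    obtain \<alpha> where \<alpha>: "a = of_real \<alpha>" using linear_factor.prems by (auto elim: Reals_cases)
    have ne: "complex_of_real c - a \<noteq> 0" using linear_factor.prems by auto
    let ?u = "complex_of_real c - a" and ?r = "poly p c" and ?r' = "poly (pderiv p) c"
      and ?r'' = "poly (pderiv (pderiv p)) c"
    have p': "pderiv ([:- a, 1:] * p) = [:- a, 1:] * pderiv p + p"
      by (simp only: pderiv_mult) (simp add: pderiv_pCons)
    then have p'': "pderiv (pderiv ([:- a, 1:] * p))
        = [:- a, 1:] * pderiv (pderiv p) + pderiv p + pderiv p"
      by (simp only: pderiv_add pderiv_mult) (simp add: pderiv_pCons)
    have d: "poly ([:- a, 1:] * p) c = ?u * ?r" by (simp add: algebra_simps)
    have d': "poly (pderiv ([:- a, 1:] * p)) c = ?u * ?r' + ?r"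
      unfolding p' by (simp add: algebra_simps)
    have d'': "poly (pderiv (pderiv ([:- a, 1:] * p))) c = ?u * ?r'' + 2 * ?r'"
      unfolding p'' by (simp add: algebra_simps)
    have "?u * ?r * (?u * ?r'' + 2 * ?r') - (?u * ?r' + ?r)\<^sup>2
        = ?u\<^sup>2 * (?r * ?r'' - ?r'\<^sup>2) - ?r\<^sup>2"
      by (simp add: power2_eq_square algebra_simps)
    also have "\<dots> = - of_real (S + 1 / (c - \<alpha>)\<^sup>2) * (?u * ?r)\<^sup>2"
    proof -
      have "U\<^sup>2 * (- s * r\<^sup>2) - r\<^sup>2 = - (s + 1 / U\<^sup>2) * (U * r)\<^sup>2"
        if "U \<noteq> 0" for U s r :: complex
        using that by (simp add: power_mult_distrib left_diff_distrib)
      from this[OF ne, of "of_real S" ?r] show ?thesis unfolding S(2) by (simp add: \<alpha>)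
    qed
    finally show ?case unfolding d d' d'' using S(1) by (intro exI[of _ "S + 1 / (c - \<alpha>)\<^sup>2"]) auto
  qed
  then show ?thesis using that by blast
qed

section \<open>The operator on powers of linear polynomials\<close>

lemma map_poly_of_real_mult:
  "map_poly complex_of_real (p * q) = map_poly of_real p * map_poly of_real q"
  by (rule poly_eqI) (simp add: coeff_map_poly coeff_mult)

lemma map_poly_of_real_power:
  "map_poly complex_of_real (p ^ n) = map_poly of_real p ^ n"
  by (induction n) (auto simp: map_poly_of_real_mult)

lemma poly_of_real_cnj: "cnj (poly (map_poly of_real p) (cnj z)) = poly (map_poly of_real p) z"
proof -
  have "map_poly cnj (map_poly complex_of_real p) = map_poly of_real p"
    by (rule poly_eqI) (simp add: coeff_map_poly)
  then show ?thesis by (metis poly_map_poly_cnj)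
qed

definition preserves_real_zeros :: "complex poly \<Rightarrow> complex poly \<Rightarrow> complex \<Rightarrow> bool" where
  "preserves_real_zeros M1 M2 h \<longleftrightarrow>
    (\<forall>p :: real poly. only_real_zeros (map_poly of_real p) \<longrightarrow>
      only_real_zeros (diff_op M1 M2 h (map_poly of_real p)))"

lemma preserves_real_zeros_power:
  fixes c :: real
  assumes "preserves_real_zeros M1 M2 h"
  shows "only_real_zeros (M1 * [:h - c, 1:] ^ n + M2 * [:- h - c, 1:] ^ n)"
proof -
  have eq: "map_poly complex_of_real ([:- c, 1:] ^ n) = [:- of_real c, 1:] ^ n"
    by (simp add: map_poly_of_real_power map_poly_pCons)
  have "only_real_zeros ([:- of_real c, 1:] ^ n)" by (auto simp: only_real_zeros_def)
  then have "only_real_zeros (diff_op M1 M2 h ([:- of_real c, 1:] ^ n))"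
    using assms unfolding preserves_real_zeros_def by (metis eq)
  moreover have "diff_op M1 M2 h ([:- of_real c, 1:] ^ n)
      = M1 * [:h - c, 1:] ^ n + M2 * [:- h - c, 1:] ^ n"
    by (subst poly_eq_poly_eq_iff [symmetric]) (auto simp: fun_eq_iff poly_diff_op algebra_simps)
  ultimately show ?thesis by simp
qed

text \<open>At \<open>z = c\<close> the linear factor takes the value \<open>u\<close>. The exponent \<open>m + 2\<close> lets the common power
  \<open>u ^ m\<close> be pulled out of the value and of both derivatives, after which the dependence on the
  exponent is polynomial.\<close>

lemma poly_pderiv_times_linear_power:
  fixes M :: "complex poly"
  shows "poly (M * [:u - c, 1:] ^ (m + 2)) c = u ^ m * (u\<^sup>2 * poly M c)"
    and "poly (pderiv (M * [:u - c, 1:] ^ (m + 2))) c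
      = u ^ m * (u\<^sup>2 * poly (pderiv M) c + of_nat (m + 2) * u * poly M c)"
    and "poly (pderiv (pderiv (M * [:u - c, 1:] ^ (m + 2)))) c
      = u ^ m * (u\<^sup>2 * poly (pderiv (pderiv M)) c + 2 * of_nat (m + 2) * u * poly (pderiv M) c
          + of_nat (m + 2) * (of_nat (m + 2) - 1) * poly M c)"
proof -
  define L where "L = [:u - c, 1:]"
  have L: "poly L c = u" "pderiv L = 1" by (simp_all add: L_def pderiv_pCons one_pCons)
  have e: "m + 2 = Suc (Suc m)" by simp
  have d: "pderiv (L ^ Suc k) = smult (of_nat (Suc k)) (L ^ k)" for k
    by (simp only: pderiv_power_Suc L mult_1_right)
  show "poly (M * [:u - c, 1:] ^ (m + 2)) c = u ^ m * (u\<^sup>2 * poly M c)"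
    unfolding L_def [symmetric] by (simp add: L power2_eq_square)
  show "poly (pderiv (M * [:u - c, 1:] ^ (m + 2))) c
      = u ^ m * (u\<^sup>2 * poly (pderiv M) c + of_nat (m + 2) * u * poly M c)"
    unfolding L_def [symmetric] e pderiv_mult d
    by (simp add: L power2_eq_square algebra_simps)
  show "poly (pderiv (pderiv (M * [:u - c, 1:] ^ (m + 2)))) c
      = u ^ m * (u\<^sup>2 * poly (pderiv (pderiv M)) c + 2 * of_nat (m + 2) * u * poly (pderiv M) c
          + of_nat (m + 2) * (of_nat (m + 2) - 1) * poly M c)"
    unfolding L_def [symmetric] e pderiv_mult pderiv_add d pderiv_smult
    by (simp add: L power2_eq_square algebra_simps)
qed

section \<open>The shift is purely imaginary\<close>

text \<open>The limit, as \<open>n\<close> runs through the integers of the parity given by \<open>\<sigma>\<close>, of the Laguerre inequality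
  at \<open>c\<close> for the image of \<open>(x - c)^n\<close>, divided by \<open>n^2\<close>. The parity is fixed because the value of
  the image at \<open>c\<close> is \<open>h^n (m1 + (-1)^n m2)\<close>.\<close>

lemma Laguerre_limit:
  fixes M1 M2 :: "complex poly" and c :: real and h \<sigma> :: complex
  defines "m1 \<equiv> poly M1 c" and "m2 \<equiv> poly M2 c"
  assumes pres: "preserves_real_zeros M1 M2 h" and "h \<noteq> 0"
    and \<sigma>: "\<sigma> = (-1) ^ j" and nz: "m1 + \<sigma> * m2 \<noteq> 0"
  obtains s where "s \<ge> 0" "4 * \<sigma> * m1 * m2 = - of_real s * (h * (m1 + \<sigma> * m2))\<^sup>2"
proof -
  define D E where "D = m1 + \<sigma> * m2" and "E = m1 - \<sigma> * m2"
  define D1 E1 where "D1 = poly (pderiv M1) c + \<sigma> * poly (pderiv M2) c"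
    and "E1 = poly (pderiv M1) c - \<sigma> * poly (pderiv M2) c"
  define D2 where "D2 = poly (pderiv (pderiv M1)) c + \<sigma> * poly (pderiv (pderiv M2)) c"
  \<comment> \<open>\<open>D\<close>, \<open>E\<close> and their numbered versions collect the values and derivatives of the coefficients.
    In terms of \<open>\<epsilon> = 1 / n\<close>, the Laguerre quotient divided by \<open>n^2\<close> is a polynomial in \<open>\<epsilon>\<close>,
    called \<open>f\<close> below, so its limit is the value at \<open>\<epsilon> = 0\<close>.\<close>
  define n where "n k = 2 * k + j + 2" for k
  define \<epsilon> :: "nat \<Rightarrow> complex" where "\<epsilon> k = 1 / of_nat (n k)" for k
  define f where "f k = (D * (h\<^sup>2 * D2 * \<epsilon> k ^ 2 + 2 * h * E1 * \<epsilon> k + (1 - \<epsilon> k) * D)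
      - (h * D1 * \<epsilon> k + E)\<^sup>2) / (h * D)\<^sup>2" for k
  have f_nonpos: "\<exists>s\<ge>0. f k = - of_real s" for k
  proof -
    let ?m = "2 * k + j"
    define q where "q = M1 * [:h - c, 1:] ^ (?m + 2) + M2 * [:- h - c, 1:] ^ (?m + 2)"
    have sgn: "(- h) ^ ?m = \<sigma> * h ^ ?m"
      by (simp add: \<sigma> power_minus[of h] power_add power_mult)
    have q0: "poly q c = h ^ ?m * (h\<^sup>2 * D)"
      unfolding q_def poly_add poly_pderiv_times_linear_power sgn
      by (simp add: D_def m1_def m2_def algebra_simps)
    have q1: "poly (pderiv q) c = h ^ ?m * (h\<^sup>2 * D1 + of_nat (n k) * h * E)"
      unfolding q_def pderiv_add poly_add poly_pderiv_times_linear_power sgn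
      by (simp add: D1_def E_def n_def m1_def m2_def algebra_simps)
    have q2: "poly (pderiv (pderiv q)) c
        = h ^ ?m * (h\<^sup>2 * D2 + 2 * of_nat (n k) * h * E1 + of_nat (n k) * (of_nat (n k) - 1) * D)"
      unfolding q_def pderiv_add poly_add poly_pderiv_times_linear_power sgn
      by (simp add: D2_def E1_def D_def n_def m1_def m2_def algebra_simps)
    have "only_real_zeros q"
      unfolding q_def by (rule preserves_real_zeros_power[OF pres])
    moreover have "poly q c \<noteq> 0" using nz \<open>h \<noteq> 0\<close> by (simp add: q0 D_def)
    ultimately obtain S where S: "S \<ge> 0" "poly q c * poly (pderiv (pderiv q)) c - (poly (pderiv q) c)\<^sup>2
        = - of_real S * (poly q c)\<^sup>2"
      by (rule real_rooted_Laguerre)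
    define N :: complex where "N = of_nat (n k)"
    have N: "N \<noteq> 0" "\<epsilon> k = 1 / N" by (simp_all add: N_def n_def \<epsilon>_def flip: of_nat_Suc of_nat_add)
    have "(h ^ ?m)\<^sup>2 * (h\<^sup>2 * (D * (h\<^sup>2 * D2 + 2 * N * h * E1 + N * (N - 1) * D)
        - (h * D1 + N * E)\<^sup>2)) = (h ^ ?m)\<^sup>2 * (h\<^sup>2 * (- of_real S * h\<^sup>2 * D\<^sup>2))"
      using S(2) unfolding q0 q1 q2 N_def [symmetric]
      by (simp add: algebra_simps power2_eq_square)
    then have "D * (h\<^sup>2 * D2 + 2 * N * h * E1 + N * (N - 1) * D) - (h * D1 + N * E)\<^sup>2
        = - of_real S * h\<^sup>2 * D\<^sup>2"
      using \<open>h \<noteq> 0\<close> by (simp only: mult_cancel_left) auto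
    moreover have "f k = (D * (h\<^sup>2 * D2 + 2 * N * h * E1 + N * (N - 1) * D)
        - (h * D1 + N * E)\<^sup>2) / (N\<^sup>2 * (h * D)\<^sup>2)"
      using N(1) unfolding f_def N(2) by (simp add: divide_simps) (simp add: algebra_simps power2_eq_square)
    ultimately have "f k = - of_real S * h\<^sup>2 * D\<^sup>2 / (N\<^sup>2 * (h * D)\<^sup>2)" by simp
    also have "\<dots> = - of_real (S / (real (n k))\<^sup>2)"
      using nz \<open>h \<noteq> 0\<close> by (simp add: D_def power_mult_distrib N_def)
    finally show ?thesis using S(1) by (intro exI[of _ "S / (real (n k))\<^sup>2"]) auto
  qed
  have "strict_mono n" by (auto simp: strict_mono_def n_def)
  then have "\<epsilon> \<longlonglongrightarrow> 0"
    using LIMSEQ_subseq_LIMSEQ[OF lim_1_over_n, of n] unfolding \<epsilon>_def o_def by simp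
  then have "f \<longlonglongrightarrow> (D * (h\<^sup>2 * D2 * 0 ^ 2 + 2 * h * E1 * 0 + (1 - 0) * D) - (h * D1 * 0 + E)\<^sup>2) / (h * D)\<^sup>2"
    unfolding f_def by (intro tendsto_intros) (use nz \<open>h \<noteq> 0\<close> in \<open>auto simp: D_def\<close>)
  also have "(D * (h\<^sup>2 * D2 * 0 ^ 2 + 2 * h * E1 * 0 + (1 - 0) * D) - (h * D1 * 0 + E)\<^sup>2) / (h * D)\<^sup>2
      = 4 * \<sigma> * m1 * m2 / (h * D)\<^sup>2" (is "_ = ?L")
    by (simp add: D_def E_def power2_eq_square algebra_simps)
  finally have lim: "f \<longlonglongrightarrow> ?L" .
  have "Re (f k) \<le> 0" "Im (f k) = 0" for k using f_nonpos[of k] by auto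
  then have "Re ?L \<le> 0" "Im ?L = 0"
    using tendsto_Re[OF lim] tendsto_Im[OF lim] LIMSEQ_le_const2[of "\<lambda>k. Re (f k)"]
    by (auto simp: LIMSEQ_const_iff)
  then have "?L = - of_real (- Re ?L)" by (simp add: complex_eq_iff)
  moreover have "4 * \<sigma> * m1 * m2 = ?L * (h * D)\<^sup>2"
    using nz \<open>h \<noteq> 0\<close> unfolding D_def [symmetric] by simp
  ultimately have "4 * \<sigma> * m1 * m2 = - of_real (- Re ?L) * (h * D)\<^sup>2" by metis
  then show ?thesis using that[of "- Re ?L"] \<open>Re ?L \<le> 0\<close> by (simp add: D_def)
qed

lemma Re_0_if_square_nonpos:
  assumes "h\<^sup>2 = - complex_of_real s" and "s \<ge> 0"
  shows "Re h = 0"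
proof (rule ccontr)
  assume "Re h \<noteq> 0"
  moreover have "Re (h\<^sup>2) = - s" "Im (h\<^sup>2) = 0" using assms by simp_all
  ultimately have "Im h = 0" "(Re h)\<^sup>2 = - s" by (auto simp: power2_eq_square)
  then show False using assms(2) \<open>Re h \<noteq> 0\<close> by (smt (verit) zero_less_power2)
qed

lemma exists_real_non_root:
  assumes "P \<noteq> (0 :: complex poly)"
  obtains c :: real where "poly P (of_real c) \<noteq> 0"
proof -
  have "\<not> range complex_of_real \<subseteq> {z. poly P z = 0}"
    using poly_roots_finite[OF assms] finite_subset infinite_UNIV_char_0[where 'a=real]
    by (metis finite_imageD inj_of_real)
  then show ?thesis using that by auto
qed

text \<open>Let \<open>a\<close> and \<open>b\<close> be the nonzero values of \<open>M1\<close> and \<open>M2\<close> at a real point. Unless \<open>a = b\<close> or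
  \<open>a = - b\<close>, the two parities give negative reals
  \<open>4 a b / (h (a + b))^2\<close> and \<open>- 4 a b / (h (a - b))^2\<close>, whose reciprocals have the sum \<open>h^2\<close>. If
  \<open>a = b\<close> or \<open>a = - b\<close>, one of them is undefined, and the other one is \<open>1 / h^2\<close>.\<close>

lemma preserves_imp_Re_0:
  assumes pres: "preserves_real_zeros M1 M2 h" and nz: "M1 \<noteq> 0" "M2 \<noteq> 0" "h \<noteq> 0"
  shows "Re h = 0"
proof -
  obtain c :: real where c: "poly (M1 * M2) c \<noteq> 0"
    using exists_real_non_root[of "M1 * M2"] nz by auto
  define a b where "a = poly M1 c" and "b = poly M2 c"
  have ab: "a \<noteq> 0" "b \<noteq> 0" using c by (auto simp: a_def b_def)
  have plus: "\<exists>s\<ge>0. 4 * a * b = - of_real s * (h * (a + b))\<^sup>2" if "a + b \<noteq> 0"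
    using Laguerre_limit[OF pres nz(3), of 1 0 c] that unfolding a_def b_def by auto
  have minus: "\<exists>s\<ge>0. - 4 * a * b = - of_real s * (h * (a - b))\<^sup>2" if "a - b \<noteq> 0"
    using Laguerre_limit[OF pres nz(3), of "-1" 1 c] that unfolding a_def b_def by auto
  consider "a = b" | "a = - b" | "a \<noteq> b" "a \<noteq> - b" by blast
  then obtain s where "s \<ge> 0" "h\<^sup>2 = - complex_of_real s"
  proof cases
    case 1
    then obtain s where s: "s \<ge> 0" "4 * b * b = - of_real s * (h * (b + b))\<^sup>2" using plus ab by auto
    then have "(4 * b * b) * - 1 = (4 * b * b) * (of_real s * h\<^sup>2)"
      by (simp add: power2_eq_square algebra_simps)
    then have "- 1 = of_real s * h\<^sup>2" using ab unfolding mult_cancel_left by simp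
    moreover from this have "s \<noteq> 0" by auto
    ultimately show ?thesis using that[of "1 / s"] s(1) by (simp add: field_simps)
  next
    case 2
    then obtain s where s: "s \<ge> 0" "4 * b * b = - of_real s * (h * (- b - b))\<^sup>2" using minus ab by auto
    then have "(4 * b * b) * - 1 = (4 * b * b) * (of_real s * h\<^sup>2)"
      by (simp add: power2_eq_square algebra_simps)
    then have "- 1 = of_real s * h\<^sup>2" using ab unfolding mult_cancel_left by simp
    moreover from this have "s \<noteq> 0" by auto
    ultimately show ?thesis using that[of "1 / s"] s(1) by (simp add: field_simps)
  next
    case 3
    then obtain s t where s: "s \<ge> 0" "4 * a * b = - of_real s * (h * (a + b))\<^sup>2"
      and t: "t \<ge> 0" "- 4 * a * b = - of_real t * (h * (a - b))\<^sup>2"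
      using plus minus by (metis add_eq_0_iff2 eq_iff_diff_eq_0)
    have "s \<noteq> 0" "t \<noteq> 0" using s t ab by auto
    then have "(h * (a + b))\<^sup>2 = - 4 * a * b / of_real s" "(h * (a - b))\<^sup>2 = 4 * a * b / of_real t"
      using s(2) t(2) by (simp_all add: field_simps)
    moreover have "h\<^sup>2 * (4 * a * b) = (h * (a + b))\<^sup>2 - (h * (a - b))\<^sup>2"
      by (simp add: power2_eq_square algebra_simps)
    ultimately have "h\<^sup>2 * (4 * a * b) = (- (1 / of_real s) - 1 / of_real t) * (4 * a * b)"
      by (simp add: algebra_simps)
    then have "h\<^sup>2 = - complex_of_real (1 / s + 1 / t)" using ab by simp
    then show ?thesis using that s(1) t(1) by (meson add_nonneg_nonneg divide_nonneg_nonneg zero_le_one)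
  qed
  then show ?thesis using Re_0_if_square_nonpos by blast
qed

section \<open>The coefficients are conjugate up to a unimodular factor\<close>

text \<open>Conjugating the image of \<open>x^n\<close> and collecting the powers gives
  \<open>(M1* - \<mu> M2) (z - h)^n = (\<mu> M1 - M2*) (z + h)^n\<close>, where the star conjugates the coefficients. The
  factor \<open>\<mu> M1 - M2*\<close> would vanish to order \<open>n\<close> at \<open>h\<close>, more than its degree permits, unless it is
  zero.\<close>

lemma preserves_imp_cnj:
  assumes pres: "preserves_real_zeros M1 M2 h" and "Re h = 0" "h \<noteq> 0"
  obtains \<mu> where "cmod \<mu> = 1" and "\<And>z. poly M1 z = \<mu> * cnj (poly M2 (cnj z))"
proof -
  define n where "n = Suc (degree M1 + degree M2)"
  define q where "q = M1 * [:h, 1:] ^ n + M2 * [:- h, 1:] ^ n"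
  have "only_real_zeros q"
    using preserves_real_zeros_power[OF pres, of 0 n] by (simp add: q_def)
  then obtain \<mu> where \<mu>: "cmod \<mu> = 1" "\<And>z. cnj (poly q (cnj z)) = \<mu> * poly q z"
    by (rule real_rooted_cnj) blast
  have h: "cnj h = - h" using \<open>Re h = 0\<close> by (simp add: complex_eq_iff)
  define P where "P = smult \<mu> M1 - map_poly cnj M2"
  have "(map_poly cnj M1 - smult \<mu> M2) * [:- h, 1:] ^ n = P * [:h, 1:] ^ n"
    using \<mu>(2) by (subst poly_eq_poly_eq_iff [symmetric])
      (simp add: fun_eq_iff q_def P_def h algebra_simps)
  then have "[:- h, 1:] ^ n dvd P * [:h, 1:] ^ n" by (metis dvd_triv_right)
  moreover have "order h ([:h, 1:] ^ n) = 0" using \<open>h \<noteq> 0\<close> by (intro order_0I) simp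
  then have "P = 0 \<or> order h (P * [:h, 1:] ^ n) \<le> degree P"
    by (cases "P = 0") (simp_all add: order_mult order_degree)
  moreover have "degree P < n"
    unfolding P_def n_def
    by (rule le_less_trans[OF degree_diff_le[of _ "degree M1 + degree M2"]])
      (auto intro: order_trans[OF degree_smult_le] order_trans[OF map_poly_degree_leq])
  ultimately have "P = 0"
    using \<open>h \<noteq> 0\<close> by (auto simp: order_divides)
  then have "\<mu> * poly M1 z = cnj (poly M2 (cnj z))" for z
    by (metis P_def eq_iff_diff_eq_0 poly_map_poly_cnj poly_smult)
  then have "poly M1 z = cnj \<mu> * cnj (poly M2 (cnj z))" for z
    using \<mu>(1) by (metis complex_norm_square mult.assoc mult.commute mult_1 of_real_1 power_one)
  then show ?thesis using that[of "cnj \<mu>"] \<mu>(1) by simp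
qed

section \<open>The location of the zeros of the coefficients\<close>

text \<open>The image \<open>q\<close> of \<open>(x - c)^n\<close> with \<open>c = Re w\<close> is compared at \<open>w\<close> and at a point \<open>u t\<close> of the vertical
  segment from \<open>w\<close> to the real axis. Close to \<open>w\<close>, the distance \<open>R\<close> from \<open>u t + h\<close> to \<open>c\<close> exceeds the
  distances \<open>r1\<close> from \<open>u t - h\<close> and \<open>r2\<close> from \<open>w - h\<close> to \<open>c\<close>. Hence \<open>|q(u t)|\<close> is of order \<open>R^n\<close> if
  \<open>M1\<close> does not vanish at \<open>u t\<close>, whereas \<open>|q(w)|\<close> is only of order \<open>r2^n\<close>.\<close>

lemma preserves_imp_zero_location:
  assumes pres: "preserves_real_zeros M1 M2 h" and "Re h = 0" "M1 \<noteq> 0" and root: "poly M1 w = 0"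
  shows "Im h * Im w \<le> 0"
proof (rule ccontr)
  define b v c where "b = Im h" and "v = Im w" and "c = Re w"
  assume "\<not> Im h * Im w \<le> 0"
  then have bv: "b * v > 0" by (simp add: b_def v_def)
  define u where "u t = Complex c ((1 - t) * v)" for t
  \<comment> \<open>The bound on \<open>t\<close> that guarantees \<open>r2 < R\<close>: up to the term \<open>(t v)^2\<close>, the difference
    \<open>R^2 - r2^2\<close> equals \<open>2 (2 b v - t (v^2 + b v))\<close>.\<close>
  define \<delta> where "\<delta> = min 1 (2 * b * v / (v\<^sup>2 + b * v))"
  have "v\<^sup>2 + b * v > 0" using bv by (simp add: add_nonneg_pos)
  then have "\<delta> > 0" using bv by (simp add: \<delta>_def)
  have "\<not> u ` {0<..<\<delta>} \<subseteq> {z. poly M1 z = 0}"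
  proof
    assume "u ` {0<..<\<delta>} \<subseteq> {z. poly M1 z = 0}"
    then have "finite (u ` {0<..<\<delta>})" using poly_roots_finite[OF \<open>M1 \<noteq> 0\<close>] finite_subset by blast
    moreover have "inj_on u {0<..<\<delta>}" using bv by (auto simp: inj_on_def u_def)
    ultimately show False using infinite_Ioo[OF \<open>\<delta> > 0\<close>] by (simp add: finite_image_iff)
  qed
  then obtain t where "t \<in> {0<..<\<delta>}" "poly M1 (u t) \<noteq> 0" by blast
  then have t: "0 < t" "t < \<delta>" "poly M1 (u t) \<noteq> 0" by auto
  then have t1: "t < 1" and tv: "t * (v\<^sup>2 + b * v) < 2 * b * v"
    using \<open>v\<^sup>2 + b * v > 0\<close> by (auto simp: \<delta>_def field_simps)
  define R r1 r2 where "R = \<bar>(1 - t) * v + b\<bar>" and "r1 = \<bar>(1 - t) * v - b\<bar>" and "r2 = \<bar>v - b\<bar>"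
  have "(1 - t) * (b * v) > 0" using t1 bv by simp
  then have "r1\<^sup>2 < R\<^sup>2" by (simp add: R_def r1_def power2_eq_square algebra_simps)
  then have r1: "r1 < R" by (rule power_less_imp_less_base) (simp add: R_def)
  have "(t * v)\<^sup>2 \<ge> 0" by simp
  then have "r2\<^sup>2 < R\<^sup>2" using tv by (simp add: R_def r2_def power2_eq_square algebra_simps)
  then have r2: "r2 < R" by (rule power_less_imp_less_base) (simp add: R_def)
  have "R > 0" using r1 by (simp add: r1_def)
  have bound: "cmod (poly M1 (u t))
      \<le> cmod (poly M2 (u t)) * (r1 / R) ^ n + cmod (poly M2 w) * (r2 / R) ^ n" for n
  proof -
    define q where "q = M1 * [:h - c, 1:] ^ n + M2 * [:- h - c, 1:] ^ n"
    have shifts: "w - h - c = \<i> * of_real (v - b)" "u t + h - c = \<i> * of_real ((1 - t) * v + b)"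
      "u t - h - c = \<i> * of_real ((1 - t) * v - b)"
      using \<open>Re h = 0\<close> by (auto simp: u_def b_def v_def c_def complex_eq_iff)
    have "poly q w = poly M2 w * (w - h - c) ^ n" by (simp add: q_def root algebra_simps)
    then have w: "cmod (poly q w) = cmod (poly M2 w) * r2 ^ n"
      unfolding shifts r2_def by (simp add: norm_mult norm_power del: of_real_diff)
    have "poly q (u t) = poly M1 (u t) * (u t + h - c) ^ n + poly M2 (u t) * (u t - h - c) ^ n"
      by (simp add: q_def algebra_simps)
    then have "cmod (poly q (u t)) \<ge> cmod (poly M1 (u t) * (u t + h - c) ^ n)
        - cmod (poly M2 (u t) * (u t - h - c) ^ n)"
      by (metis norm_diff_ineq)
    then have "cmod (poly q (u t)) \<ge> cmod (poly M1 (u t)) * R ^ n - cmod (poly M2 (u t)) * r1 ^ n"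
      unfolding shifts R_def r1_def norm_mult norm_power norm_ii norm_of_real by simp
    moreover have "cmod (poly q (u t)) \<le> cmod (poly q w)"
    proof (rule real_rooted_cmod_mono)
      show "only_real_zeros q" unfolding q_def by (rule preserves_real_zeros_power[OF pres])
      show "\<bar>Im (u t)\<bar> \<le> \<bar>Im w\<bar>"
        using t(1) t1 by (simp add: u_def v_def abs_mult mult_left_le_one_le)
    qed (simp add: u_def c_def)
    ultimately have "cmod (poly M1 (u t)) * R ^ n
        \<le> cmod (poly M2 (u t)) * r1 ^ n + cmod (poly M2 w) * r2 ^ n"
      using w by simp
    then show ?thesis using \<open>R > 0\<close> by (simp add: field_simps power_divide)
  qed
  have "(\<lambda>n. cmod (poly M2 (u t)) * (r1 / R) ^ n + cmod (poly M2 w) * (r2 / R) ^ n)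
      \<longlonglongrightarrow> cmod (poly M2 (u t)) * 0 + cmod (poly M2 w) * 0"
    using r1 r2 \<open>R > 0\<close> by (intro tendsto_intros LIMSEQ_power_zero) (auto simp: r1_def r2_def)
  then have "cmod (poly M1 (u t)) \<le> 0"
    using LIMSEQ_le_const bound by fastforce
  then show False using t(3) by simp
qed

section \<open>Sufficiency\<close>

lemma zero_free_imp_const:
  assumes "\<And>z. poly P z \<noteq> 0"
  obtains c :: complex where "P = [:c:]"
  using assms fundamental_theorem_of_algebra[of P] constant_degree degree_0_id by metis

text \<open>A zero at \<open>z\<close> would force \<open>|M1(z)| |p(z + h)| = |M2(z)| |p(z - h)|\<close>. The point \<open>z\<close> lies on the same side
  of the real axis as every nonreal zero of \<open>M2\<close>, and \<open>|M1(z)| = |M2(cnj z)|\<close>, so \<open>|M2(z)| \<le> |M1(z)|\<close>. Since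
  \<open>z + h\<close> lies vertically farther from the real axis than \<open>z - h\<close>, also
  \<open>|p(z - h)| \<le> |p(z + h)|\<close>. A zero of \<open>p\<close> or a nonreal zero of \<open>M2\<close> makes the comparison strict.\<close>

lemma cnj_pair_no_zero_above:
  fixes p :: "real poly"
  assumes h: "Re h = 0" "h \<noteq> 0" and \<mu>: "cmod \<mu> = 1"
    and M1: "\<And>z. poly M1 z = \<mu> * cnj (poly M2 (cnj z))"
    and zeros: "\<And>z. poly M2 z = 0 \<Longrightarrow> Im h * Im z \<ge> 0"
    and p: "only_real_zeros (map_poly of_real p)"
    and nz: "diff_op M1 M2 h (map_poly of_real p) \<noteq> 0"
    and z: "Im h * Im z > 0"
  shows "poly (diff_op M1 M2 h (map_poly of_real p)) z \<noteq> 0"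
proof
  define P where "P = map_poly complex_of_real p"
  assume "poly (diff_op M1 M2 h (map_poly of_real p)) z = 0"
  then have "poly M1 z * poly P (z + h) = - (poly M2 z * poly P (z - h))"
    by (simp add: poly_diff_op P_def add_eq_0_iff2)
  then have eq: "cmod (poly M1 z) * cmod (poly P (z + h)) = cmod (poly M2 z) * cmod (poly P (z - h))"
    by (metis norm_minus_cancel norm_mult)
  have "P \<noteq> 0" using nz by (auto simp: P_def diff_op_def)
  then have P_roots: "Im a = 0" if "poly P a = 0" for a
    using p that by (auto simp: only_real_zeros_def P_def complex_is_Real_iff)
  have "M2 \<noteq> 0"
  proof
    assume "M2 = 0"
    then have "M1 = 0" using M1 by (simp flip: poly_eq_poly_eq_iff add: fun_eq_iff)
    then show False using nz \<open>M2 = 0\<close> by (simp add: diff_op_def)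
  qed
  have M1_norm: "cmod (poly M1 z) = cmod (poly M2 (cnj z))" by (simp add: M1 norm_mult \<mu>)
  have cross: "0 \<le> Im z * Im a" if "0 \<le> Im h * Im a" for a
    using z that by (auto simp: zero_le_mult_iff zero_less_mult_iff)
  have M2_mono: "cmod (z - a) \<le> cmod (cnj z - a)" if "poly M2 a = 0" for a
    using cross zeros[OF that] by (auto simp: cmod_diff_le_iff power2_eq_square algebra_simps)
  have M1_nz: "poly M1 z \<noteq> 0" using zeros[of "cnj z"] z \<mu> by (auto simp: M1)
  have P_nz: "poly P (z + h) \<noteq> 0"
    using P_roots[of "z + h"] z by (auto simp: add_eq_0_iff2 mult_less_0_iff zero_less_mult_iff)
  have P_closer: "cmod (z - h - a) < cmod (z + h - a)" if "poly P a = 0" for a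
    unfolding cmod_diff_less_iff
    using P_roots[OF that] z h by (simp add: power2_eq_square algebra_simps)
  have M_le: "cmod (poly M2 z) \<le> cmod (poly M1 z)"
    unfolding M1_norm by (rule cmod_poly_mono[OF M2_mono])
  have P_le: "cmod (poly P (z - h)) \<le> cmod (poly P (z + h))"
    by (rule cmod_poly_mono) (use P_closer in force)
  show False
  proof (cases "(\<exists>a. poly P a = 0) \<or> (\<exists>a. poly M2 a = 0 \<and> Im a \<noteq> 0)")
    case True
    then show False
    proof
      assume "\<exists>a. poly P a = 0"
      then have "cmod (poly P (z - h)) < cmod (poly P (z + h))"
        using P_closer P_nz by (metis cmod_poly_strict_mono less_imp_le)
      then have "cmod (poly M2 z) * cmod (poly P (z - h)) < cmod (poly M1 z) * cmod (poly P (z + h))"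
        using M_le M1_nz by (smt (verit) mult_left_mono mult_right_mono mult_strict_left_mono
            norm_ge_zero zero_less_norm_iff)
      then show False using eq by simp
    next
      assume "\<exists>a. poly M2 a = 0 \<and> Im a \<noteq> 0"
      then obtain a where a: "poly M2 a = 0" "Im a \<noteq> 0" by blast
      have "cmod (poly M2 z) < cmod (poly M1 z)"
        unfolding M1_norm
      proof (rule cmod_poly_strict_mono[OF M2_mono a(1)])
        show "cmod (z - a) < cmod (cnj z - a)"
        proof -
          have "Im z * Im a \<noteq> 0" using a(2) z by auto
          then have "0 < Im z * Im a"
            using cross[OF zeros[OF a(1)]] by (metis order_le_less)
          then show ?thesis
            unfolding cmod_diff_less_iff by (simp add: power2_eq_square algebra_simps)
        qed
        show "poly M2 (cnj z) \<noteq> 0" using M1_nz M1_norm by auto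
      qed
      then have "cmod (poly M2 z) * cmod (poly P (z - h)) < cmod (poly M1 z) * cmod (poly P (z + h))"
        using P_le P_nz by (smt (verit) mult_left_mono mult_strict_right_mono
            norm_ge_zero zero_less_norm_iff)
      then show False using eq by simp
    qed
  next
    case False
    then have "only_real_zeros M2" by (auto simp: only_real_zeros_def complex_is_Real_iff)
    then obtain \<nu> where "cmod \<nu> = 1" and \<nu>: "\<And>z. cnj (poly M2 (cnj z)) = \<nu> * poly M2 z"
      by (rule real_rooted_cnj) (rule that)
    obtain k where k: "P = [:k:]" using False zero_free_imp_const by metis
    have q: "diff_op M1 M2 h P = smult ((\<mu> * \<nu> + 1) * k) M2"
      by (subst poly_eq_poly_eq_iff [symmetric])
        (simp add: fun_eq_iff poly_diff_op k M1 \<nu> algebra_simps)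
    then have "poly M2 z = 0"
      using nz \<open>poly (diff_op M1 M2 h (map_poly of_real p)) z = 0\<close> by (auto simp flip: P_def)
    then show False using False z by auto
  qed
qed

text \<open>The image of a real polynomial is, up to the factor \<open>\<mu>\<close>, its own conjugate, because conjugation
  swaps the two summands. So its zeros are symmetric about the real axis, and it suffices to exclude
  them from one of the half-planes.\<close>

lemma cnj_pair_preserves:
  assumes h: "Re h = 0" "h \<noteq> 0" and \<mu>: "cmod \<mu> = 1"
    and M1: "\<And>z. poly M1 z = \<mu> * cnj (poly M2 (cnj z))"
    and zeros: "\<And>z. poly M2 z = 0 \<Longrightarrow> Im h * Im z \<ge> 0"
  shows "preserves_real_zeros M1 M2 h"
  unfolding preserves_real_zeros_def
proof (intro allI impI)
  fix p :: "real poly"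
  assume p: "only_real_zeros (map_poly of_real p)"
  let ?q = "diff_op M1 M2 h (map_poly of_real p)"
  have ch: "cnj h = - h" using h by (simp add: complex_eq_iff)
  have pc: "cnj (poly (map_poly complex_of_real p) w) = poly (map_poly complex_of_real p) (cnj w)" for w
    using poly_of_real_cnj[of p "cnj w"] by simp
  have mm: "\<mu> * cnj \<mu> = 1" using \<mu> by (metis complex_norm_square of_real_1 power_one)
  have sym: "\<mu> * cnj (poly ?q (cnj z)) = poly ?q z" for z
  proof -
    have "\<mu> * cnj (poly ?q (cnj z)) = (\<mu> * cnj \<mu>) * (poly M2 z * poly (map_poly of_real p) (z - h))
        + poly M1 z * poly (map_poly of_real p) (z + h)"
      by (simp add: poly_diff_op M1 pc ch algebra_simps)
    then show ?thesis by (simp add: mm poly_diff_op)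
  qed
  show "only_real_zeros ?q"
  proof (cases "?q = 0")
    case False
    have "z \<in> \<real>" if z: "poly ?q z = 0" for z
    proof -
      have cz: "poly ?q (cnj z) = 0" using sym[of "cnj z"] z by simp
      have "\<not> Im h * Im z > 0" "\<not> Im h * Im (cnj z) > 0"
        using cnj_pair_no_zero_above[OF h \<mu> M1 zeros p False, of z]
          cnj_pair_no_zero_above[OF h \<mu> M1 zeros p False, of "cnj z"] z cz by auto
      then have "Im h * Im z = 0" by simp
      then show "z \<in> \<real>" using h by (auto simp: complex_is_Real_iff complex_eq_iff)
    qed
    then show ?thesis by (simp add: only_real_zeros_def)
  qed (simp add: only_real_zeros_def)
qed

lemma unimodular_exp:
  assumes "cmod \<mu> = 1"
  obtains \<theta> :: real where "0 \<le> \<theta>" "\<theta> < 2 * pi" "\<mu> = exp (\<i> * of_real \<theta>)"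
proof -
  have "(Re \<mu>)\<^sup>2 + (Im \<mu>)\<^sup>2 = 1" using assms by (simp add: cmod_def)
  then obtain t where "0 \<le> t" "t < 2 * pi" "Re \<mu> = cos t" "Im \<mu> = sin t"
    by (rule sincos_total_2pi)
  then show ?thesis using that[of t] by (simp add: complex_eq_iff Re_exp Im_exp)
qed

theorem proposition1p1:
  fixes M1 M2 :: "complex poly" and h :: complex
  assumes "M1 \<noteq> 0" and "M2 \<noteq> 0" and "h \<noteq> 0"
  shows "(\<forall>p :: real poly. only_real_zeros (map_poly of_real p) \<longrightarrow>
            only_real_zeros (diff_op M1 M2 h (map_poly of_real p)))
     \<longleftrightarrow>
         Re h = 0 \<and>
         ((\<forall>z. cmod (poly M1 z / poly M2 z) = 1) \<or>
          (\<exists>\<theta>::real. 0 \<le> \<theta> \<and> \<theta> < 2 * pi \<and>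
             (\<forall>z. poly M1 z = exp (\<i> * of_real \<theta>) * cnj (poly M2 (cnj z)))) \<and>
          (\<forall>z. poly M2 z = 0 \<longrightarrow> Im h * Im z \<ge> 0))"
  unfolding preserves_real_zeros_def [symmetric]
proof
  assume pres: "preserves_real_zeros M1 M2 h"
  then have Re: "Re h = 0" using preserves_imp_Re_0 assms by blast
  obtain \<mu> where \<mu>: "cmod \<mu> = 1" "\<And>z. poly M1 z = \<mu> * cnj (poly M2 (cnj z))"
    using preserves_imp_cnj[OF pres Re \<open>h \<noteq> 0\<close>] by blast
  obtain \<theta> :: real where \<theta>: "0 \<le> \<theta>" "\<theta> < 2 * pi" "\<mu> = exp (\<i> * of_real \<theta>)"
    using unimodular_exp[OF \<mu>(1)] .
  have "Im h * Im z \<ge> 0" if "poly M2 z = 0" for z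
    using preserves_imp_zero_location[OF pres Re \<open>M1 \<noteq> 0\<close>, of "cnj z"] that \<mu>(2)[of "cnj z"] by simp
  then show "Re h = 0 \<and> ((\<forall>z. cmod (poly M1 z / poly M2 z) = 1) \<or>
      (\<exists>\<theta>::real. 0 \<le> \<theta> \<and> \<theta> < 2 * pi \<and>
         (\<forall>z. poly M1 z = exp (\<i> * of_real \<theta>) * cnj (poly M2 (cnj z)))) \<and>
      (\<forall>z. poly M2 z = 0 \<longrightarrow> Im h * Im z \<ge> 0))"
    using Re \<theta> \<mu>(2) by blast
next
  assume "Re h = 0 \<and> ((\<forall>z. cmod (poly M1 z / poly M2 z) = 1) \<or>
      (\<exists>\<theta>::real. 0 \<le> \<theta> \<and> \<theta> < 2 * pi \<and>
         (\<forall>z. poly M1 z = exp (\<i> * of_real \<theta>) * cnj (poly M2 (cnj z)))) \<and>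
      (\<forall>z. poly M2 z = 0 \<longrightarrow> Im h * Im z \<ge> 0))"
  moreover have "cmod (exp (\<i> * of_real \<theta>)) = 1" for \<theta> :: real
    by (metis cis_conv_exp norm_cis)
  ultimately have Re: "Re h = 0" and cases: "(\<forall>z. cmod (poly M1 z / poly M2 z) = 1) \<or>
      (\<exists>\<mu>. cmod \<mu> = 1 \<and> (\<forall>z. poly M1 z = \<mu> * cnj (poly M2 (cnj z)))) \<and>
      (\<forall>z. poly M2 z = 0 \<longrightarrow> Im h * Im z \<ge> 0)"
    by blast+
  have "\<exists>\<mu>. cmod \<mu> = 1 \<and> (\<forall>z. poly M1 z = \<mu> * cnj (poly M2 (cnj z)))"
    and "\<And>z. poly M2 z = 0 \<Longrightarrow> Im h * Im z \<ge> 0"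
    using cases
  proof (atomize (full), elim disjE)
    assume quot: "\<forall>z. cmod (poly M1 z / poly M2 z) = 1"
    then have "poly M1 z \<noteq> 0 \<and> poly M2 z \<noteq> 0" for z by (metis div_by_0 divide_eq_0_iff norm_zero zero_neq_one)
    then obtain a b where ab: "M1 = [:a:]" "M2 = [:b:]"
      using zero_free_imp_const[of M1] zero_free_imp_const[of M2] by metis
    then have "b \<noteq> 0" using \<open>M2 \<noteq> 0\<close> by auto
    then show "(\<exists>\<mu>. cmod \<mu> = 1 \<and> (\<forall>z. poly M1 z = \<mu> * cnj (poly M2 (cnj z)))) \<and>
        (\<forall>z. poly M2 z = 0 \<longrightarrow> 0 \<le> Im h * Im z)"
      using quot ab by (intro conjI exI[of _ "a / cnj b"]) (auto simp: norm_divide)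
  qed auto
  then show "preserves_real_zeros M1 M2 h"
    using cnj_pair_preserves[OF Re \<open>h \<noteq> 0\<close>] by blast
qed

end
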